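(* Let $r\ge 1$ be an integer and let $X$ be an $r$-ample simplicial complex. Then $X$ contains at least $M'(r)+r$ vertices, and $M'(r)+r\;\ge\; 2^{\binom{r}{\lfloor r/2\rfloor}}+r$.
   Context: For a simplicial complex $X$, $V(X)$ is its vertex set; for $U\subseteq V(X)$, $X_U$ is the induced subcomplex on $U$ (vertex set $U$, whose simplices are exactly the simplices of $X$ with all vertices in $U$). For a vertex $v$, the link ${\rm lk}_X(v)$ is the subcomplex of all simplices $\sigma$ of $X$ with $v\notin\sigma$ such that $\sigma\cup\{v\}$ is a simplex of $X$. Simplices are nonempty; subcomplexes are allowed to be empty. For an integer $r\ge 1$, a nonempty simplicial complex $X$ is $r$-ample if for each $U\subseteq V(X)$ with $|U|\le r$ and each subcomplex $A\subseteq X_U$ (possibly empty) there is a vertex $v\in V(X)\setminus U$ with ${\rm lk}_X(v)\cap X_U=A$. $M'(n)$ denotes the number of simplicial complexes with vertices from the set $\{1,\dots,n\}$ (i.e. the number of subcomplexes, including the empty one, of the full simplex on $\{1,\dots,n\}$, where not every element needs to be a vertex); e.g. $M'(1)=2$, $M'(2)=5$, $M'(3)=19$. *)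

theory Defs
  imports Main
begin

text \<open>An abstract simplicial complex is represented by its set of simplices, which are finite and
  nonempty; the empty complex is allowed.  As the set is closed under nonempty subsets, its union
  is exactly the set of those \<^term>\<open>v\<close> such that \<^term>\<open>{v}\<close> is a simplex.\<close>

definition simplicial_complex :: "'a set set \<Rightarrow> bool" where
  "simplicial_complex X \<longleftrightarrow>
     (\<forall>\<sigma>\<in>X. finite \<sigma> \<and> \<sigma> \<noteq> {} \<and> (\<forall>\<tau>. \<tau> \<subseteq> \<sigma> \<and> \<tau> \<noteq> {} \<longrightarrow> \<tau> \<in> X))"

definition vertices :: "'a set set \<Rightarrow> 'a set" where
  "vertices X = \<Union>X"

definition subcomplex :: "'a set set \<Rightarrow> 'a set set \<Rightarrow> bool" where
  "subcomplex A X \<longleftrightarrow> simplicial_complex A \<and> A \<subseteq> X"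

definition induced :: "'a set set \<Rightarrow> 'a set \<Rightarrow> 'a set set" where
  "induced X U = {\<sigma> \<in> X. \<sigma> \<subseteq> U}"

definition link :: "'a set set \<Rightarrow> 'a \<Rightarrow> 'a set set" where
  "link X v = {\<sigma> \<in> X. v \<notin> \<sigma> \<and> insert v \<sigma> \<in> X}"

text \<open>The vertex set of an ample complex may be infinite, hence the explicit finiteness of
  \<^term>\<open>U\<close>: \<^const>\<open>card\<close> is \<open>0\<close> on infinite sets.\<close>

definition ample :: "nat \<Rightarrow> 'a set set \<Rightarrow> bool" where
  "ample r X \<longleftrightarrow> simplicial_complex X \<and> X \<noteq> {} \<and>
     (\<forall>U A. U \<subseteq> vertices X \<and> finite U \<and> card U \<le> r \<and> subcomplex A (induced X U) \<longrightarrow>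
        (\<exists>v \<in> vertices X - U. link X v \<inter> induced X U = A))"

definition num_complexes :: "nat \<Rightarrow> nat" where
  "num_complexes n = card {K :: nat set set. simplicial_complex K \<and> vertices K \<subseteq> {1..n}}"

end

theory Submission imports Defs
begin

text \<open>Ampleness lets one add a cone point over a simplex repeatedly, so \<open>X\<close> contains a simplex \<open>U\<close>
  with \<open>r\<close> vertices.  Every complex on \<open>U\<close> is then a subcomplex of \<open>X\<^sub>U\<close> and hence the trace on
  \<open>X\<^sub>U\<close> of the link of some vertex outside \<open>U\<close>; different complexes need different vertices.
  The lower bound on the number of complexes comes from those with a full
  skeleton below the middle dimension: their simplices in the middle dimension are arbitrary.\<close>

lemma simplicial_complex_closed:
  assumes "simplicial_complex K" "\<sigma> \<in> K" "\<tau> \<subseteq> \<sigma>" "\<tau> \<noteq> {}"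
  shows "\<tau> \<in> K"
  using assms unfolding simplicial_complex_def by blast

lemma simplicial_complex_image:
  assumes "simplicial_complex K"
  shows "simplicial_complex ((`) f ` K)"
proof -
  have "\<tau> \<in> (`) f ` K" if \<sigma>: "\<sigma> \<in> (`) f ` K" "\<tau> \<subseteq> \<sigma>" "\<tau> \<noteq> {}" for \<sigma> \<tau>
  proof -
    obtain \<rho> where \<rho>: "\<rho> \<in> K" "\<sigma> = f ` \<rho>"
      using \<sigma>(1) by blast
    then obtain \<rho>' where \<rho>': "\<rho>' \<subseteq> \<rho>" "\<tau> = f ` \<rho>'"
      using \<sigma>(2) by (auto simp: subset_image_iff)
    with \<sigma>(3) have "\<rho>' \<noteq> {}" by auto
    with assms \<rho>(1) \<rho>'(1) have "\<rho>' \<in> K" by (rule simplicial_complex_closed)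
    with \<rho>'(2) show ?thesis by blast
  qed
  moreover have "finite \<sigma> \<and> \<sigma> \<noteq> {}" if "\<sigma> \<in> (`) f ` K" for \<sigma>
    using assms that by (auto simp: simplicial_complex_def)
  ultimately show ?thesis
    unfolding simplicial_complex_def by blast
qed

text \<open>Induction on \<open>k\<close>: ampleness with \<open>A\<close> the whole of
  \<open>induced X U\<close> gives a vertex \<open>v\<close> outside \<open>U\<close> whose link
  contains every face of \<open>U\<close>, so \<open>insert v U\<close> again has all its faces in
  \<open>X\<close>. Speaking of nonempty subsets instead of \<open>U \<in> X\<close> lets the
  induction start at the empty set.\<close>

lemma ample_imp_simplex:
  assumes "ample r X" "k \<le> r"
  shows "\<exists>U \<subseteq> vertices X. finite U \<and> card U = k \<and> (\<forall>\<sigma>. \<sigma> \<subseteq> U \<and> \<sigma> \<noteq> {} \<longrightarrow> \<sigma> \<in> X)"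
  using assms(2)
proof (induction k)
  case 0
  show ?case by (rule exI[of _ "{}"]) auto
next
  case (Suc k)
  then obtain U where U: "U \<subseteq> vertices X" "finite U" "card U = k"
      and full: "\<And>\<sigma>. \<sigma> \<subseteq> U \<Longrightarrow> \<sigma> \<noteq> {} \<Longrightarrow> \<sigma> \<in> X"
    by auto
  have sc: "simplicial_complex X"
    using assms(1) by (simp add: ample_def)
  have "subcomplex (induced X U) (induced X U)"
    using sc unfolding subcomplex_def induced_def simplicial_complex_def by blast
  then obtain v where v: "v \<in> vertices X - U"
      and lk: "link X v \<inter> induced X U = induced X U"
    using assms(1) U Suc.prems unfolding ample_def by (metis Suc_leD)
  have "\<sigma> \<in> X" if \<sigma>: "\<sigma> \<subseteq> insert v U" "\<sigma> \<noteq> {}" for \<sigma>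
  proof (cases "v \<in> \<sigma>")
    case False
    with \<sigma> full show ?thesis by blast
  next
    case True
    then have split: "\<sigma> = insert v (\<sigma> - {v})" by auto
    have sub: "\<sigma> - {v} \<subseteq> U" using \<sigma> by auto
    show ?thesis
    \<comment> \<open>The link has only nonempty simplices, so it cannot supply \<open>{v}\<close>;
      this face comes from \<open>v\<close> being a vertex.\<close>
    proof (cases "\<sigma> - {v} = {}")
      case True
      obtain \<tau> where "\<tau> \<in> X" "v \<in> \<tau>" using v unfolding vertices_def by auto
      then have "{v} \<in> X" using simplicial_complex_closed[OF sc, of \<tau> "{v}"] by simp
      moreover have "\<sigma> = {v}" using True split by metis
      ultimately show ?thesis by simp
    next
      case False
      with sub full have "\<sigma> - {v} \<in> induced X U" by (simp add: induced_def)
      with lk have "\<sigma> - {v} \<in> link X v" by blast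
      then have "insert v (\<sigma> - {v}) \<in> X" by (simp add: link_def)
      with split show ?thesis by metis
    qed
  qed
  then show ?case
    using U v by (intro exI[of _ "insert v U"]) auto
qed

lemma num_complexes_le_card_vertices:
  assumes "ample r X" "finite (vertices X)"
  shows "num_complexes r + r \<le> card (vertices X)"
proof -
  obtain U where U: "U \<subseteq> vertices X" "finite U" "card U = r"
      and full: "\<And>\<sigma>. \<sigma> \<subseteq> U \<Longrightarrow> \<sigma> \<noteq> {} \<Longrightarrow> \<sigma> \<in> X"
    using ample_imp_simplex[OF assms(1) order_refl] by auto
  \<comment> \<open>\<open>num_complexes r\<close> counts complexes on \<open>{1..r}\<close>;
    relabelling by \<open>f\<close> moves them to \<open>U\<close>.\<close>
  obtain f where f: "bij_betw f {1..r} U"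
    using U finite_same_card_bij[of "{1..r}" U] by auto
  define \<K> where "\<K> = {K. simplicial_complex K \<and> vertices K \<subseteq> {1..r}}"
  have "\<exists>v \<in> vertices X - U. link X v \<inter> induced X U = (`) f ` K" if K: "K \<in> \<K>" for K
  proof -
    have "(`) f ` K \<subseteq> induced X U"
    proof clarify
      fix \<sigma> assume "\<sigma> \<in> K"
      with K have "\<sigma> \<noteq> {}" "\<sigma> \<subseteq> {1..r}"
        unfolding \<K>_def simplicial_complex_def vertices_def by auto
      with f have "f ` \<sigma> \<subseteq> U" "f ` \<sigma> \<noteq> {}"
        by (auto simp: bij_betw_def)
      with full show "f ` \<sigma> \<in> induced X U" by (simp add: induced_def)
    qed
    then have "subcomplex ((`) f ` K) (induced X U)"
      using K simplicial_complex_image unfolding \<K>_def subcomplex_def by blast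
    with assms(1) U show ?thesis unfolding ample_def by blast
  qed
  then obtain g where g: "\<And>K. K \<in> \<K> \<Longrightarrow> g K \<in> vertices X - U"
      "\<And>K. K \<in> \<K> \<Longrightarrow> link X (g K) \<inter> induced X U = (`) f ` K"
    by metis
  \<comment> \<open>The link of \<open>g K\<close> determines the relabelled copy of
    \<open>K\<close>. Relabelling is injective on families of subsets of \<open>{1..r}\<close>, so
    \<open>g K\<close> determines \<open>K\<close>.\<close>
  have "inj_on ((`) ((`) f)) (Pow (Pow {1..r}))"
    using f by (intro inj_on_image_Pow) (simp add: bij_betw_def)
  moreover have "\<K> \<subseteq> Pow (Pow {1..r})"
    unfolding \<K>_def vertices_def by auto
  ultimately have "inj_on ((`) ((`) f)) \<K>"
    by (rule inj_on_subset)
  with g(2) have "inj_on g \<K>"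
    by (metis (no_types, lifting) inj_on_def)
  with g(1) assms(2) have "card \<K> \<le> card (vertices X - U)"
    by (intro card_inj_on_le[of g]) auto
  \<comment> \<open>The values of \<open>g\<close> avoid \<open>U\<close>, so the \<open>r\<close>
    vertices of \<open>U\<close> come on top of the \<open>num_complexes r\<close> values.\<close>
  with U assms(2) show ?thesis
    unfolding num_complexes_def \<K>_def
    using card_mono[OF assms(2) U(1)] by (simp add: card_Diff_subset)
qed

text \<open>Positivity of \<open>k\<close> matters: the empty set is not a simplex.\<close>

lemma two_power_binomial_le_num_complexes:
  assumes "0 < k"
  shows "2 ^ (n choose k) \<le> num_complexes n"
proof -
  define L where "L = {\<sigma>. \<sigma> \<subseteq> {1..n} \<and> card \<sigma> = k}"
  define S where "S = {\<sigma>. \<sigma> \<subseteq> {1..n} \<and> \<sigma> \<noteq> {} \<and> card \<sigma> < k}"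
  define \<K> where "\<K> = {K. simplicial_complex K \<and> vertices K \<subseteq> {1..n}}"
  have "finite L" "card L = n choose k"
    unfolding L_def using n_subsets[of "{1..n}" k] by auto
  then have "2 ^ (n choose k) = card (Pow L)"
    by (simp add: card_Pow)
  also have "\<dots> \<le> card \<K>"
  proof (rule card_inj_on_le)
    show "inj_on ((\<union>) S) (Pow L)"
    proof (rule inj_onI)
      fix F G assume "F \<in> Pow L" "G \<in> Pow L" "S \<union> F = S \<union> G"
      moreover have "S \<inter> L = {}" by (auto simp: S_def L_def)
      ultimately show "F = G" by blast
    qed
    show "(\<union>) S ` Pow L \<subseteq> \<K>"
    proof clarify
      fix F assume F: "F \<subseteq> L"
      have "\<tau> \<in> S \<union> F" if "\<sigma> \<in> S \<union> F" "\<tau> \<subseteq> \<sigma>" "\<tau> \<noteq> {}" for \<sigma> \<tau>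
      \<comment> \<open>A proper nonempty face of a simplex of \<open>S \<union> F\<close> has fewer
        than \<open>k\<close> elements, so it lies in \<open>S\<close> whatever \<open>F\<close>
        is.\<close>
      proof (cases "\<tau> = \<sigma>")
        case False
        have \<sigma>: "\<sigma> \<subseteq> {1..n}" "card \<sigma> \<le> k"
          using that(1) F unfolding S_def L_def by auto
        then have "card \<tau> < card \<sigma>"
          using False that(2) by (meson finite_atLeastAtMost finite_subset psubsetI psubset_card_mono)
        with \<sigma> that show ?thesis by (auto simp: S_def)
      qed (use that in simp)
      moreover have "finite \<sigma> \<and> \<sigma> \<noteq> {} \<and> \<sigma> \<subseteq> {1..n}" if "\<sigma> \<in> S \<union> F" for \<sigma>
        using that F assms finite_subset[of \<sigma> "{1..n}"] unfolding S_def L_def by auto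
      ultimately show "S \<union> F \<in> \<K>"
        unfolding \<K>_def simplicial_complex_def vertices_def by blast
    qed
    have "\<K> \<subseteq> Pow (Pow {1..n})"
      unfolding \<K>_def vertices_def by auto
    then show "finite \<K>" by (rule finite_subset) simp
  qed
  finally show ?thesis by (simp add: num_complexes_def \<K>_def)
qed

theorem corollary2p6:
  fixes X :: "'a set set" and r :: nat
  assumes "r \<ge> 1" and "ample r X"
  shows "(infinite (vertices X) \<or> card (vertices X) \<ge> num_complexes r + r) \<and>
         num_complexes r + r \<ge> 2 ^ (r choose (r div 2)) + r"
proof -
  \<comment> \<open>For \<open>r = 1\<close> the lower middle \<open>r div 2\<close> is 0, where the
    counting bound does not apply; the upper middle has the same binomial coefficient and is
    positive.\<close>
  have "r choose (r div 2) = r choose (r - r div 2)"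
    by (rule binomial_symmetric) simp
  moreover have "0 < r - r div 2"
    using assms(1) by simp
  ultimately have "2 ^ (r choose (r div 2)) \<le> num_complexes r"
    using two_power_binomial_le_num_complexes by metis
  with num_complexes_le_card_vertices[OF assms(2)] show ?thesis by auto
qed

end
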